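(* Let $t_1,t_2,r_1,r_2$ be positive integers and let $H_{iq}$, $i,q\in\{1,2\}$, be mutually independent random matrices such that $H_{iq}$ is an $r_i\times t_q$ zero-mean spatially white (ZMSW) channel. Assume $t_i\ge r_j$ for all $i\neq j$ in $\{1,2\}$. For $i\ne j$ in $\{1,2\}$ let $T_i$ be user $i$'s pre-coding matrix, i.e. the $t_i\times(t_i-r_j)$ matrix whose columns are orthonormal eigenvectors of $G_i=H_{ji}^*H_{ji}$ belonging to its null space, as defined in the context. Then, for each $i\in\{1,2\}$ with $j\ne i$, the equivalent channel $\tilde H_{ii}=H_{ii}T_i$ is an $r_i\times(t_i-r_j)$ ZMSW channel.
   Context: A random complex matrix is called a zero-mean spatially white (ZMSW) channel if its entries are i.i.d. zero-mean unit-variance circular (i.e. circularly symmetric) complex Gaussian random variables. Pre-coding matrix: for $i\neq j$ in $\{1,2\}$ let $G_i=H_{ji}^*H_{ji}\in\mathbb{C}^{t_i\times t_i}$ and let $G_i=W_i\Lambda_iW_i^*$ be its eigenvalue decomposition, with $W_i$ unitary and $\Lambda_i$ diagonal. Then $T_i=[w_{q_1},\dots,w_{q_{t_i-r_j}}]$, where $w_q$ is the $q$-th column of $W_i$ and $q_1,\dots,q_{t_i-r_j}$ are distinct indices selecting eigenvectors in the null space of $G_i$, i.e. $w_{q_k}^*G_iw_{q_k}=0$ for $k=1,\dots,t_i-r_j$. The decomposition and the choice of indices are determined from $G_i$ alone, so that $T_i$ is a measurable function of $G_i$. If $t_i=r_j$, then $T_i$ and $\tilde H_{ii}$ have no columns.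 Here $^*$ denotes conjugate transpose. *)

theory Defs
  imports "HOL-Probability.Probability" "Jordan_Normal_Form.Schur_Decomposition"
begin

text \<open>The sigma-algebra on complex \<open>n \<times> m\<close> matrices generated by the matrix entries.\<close>

definition borel_mat :: "nat \<Rightarrow> nat \<Rightarrow> complex mat measure" where
  "borel_mat n m =
     vimage_algebra (carrier_mat n m) (\<lambda>A. \<lambda>k\<in>{..<n} \<times> {..<m}. A $$ k)
       (\<Pi>\<^sub>M k\<in>{..<n} \<times> {..<m}. borel)"

text \<open>Constants count as (degenerate) Gaussian random variables, so that joint Gaussianity can be
  expressed through all linear combinations, the zero combination included.\<close>

definition gaussian_rv :: "'w measure \<Rightarrow> ('w \<Rightarrow> real) \<Rightarrow> bool" where
  "gaussian_rv M X \<longleftrightarrow>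
     X \<in> borel_measurable M \<and>
     ((\<exists>\<mu> \<sigma>. \<sigma> > 0 \<and> distributed M lborel X (\<lambda>x. ennreal (normal_density \<mu> \<sigma> x))) \<or>
      (\<exists>\<mu>. AE \<omega> in M. X \<omega> = \<mu>))"

definition complex_gaussian_rv :: "'w measure \<Rightarrow> ('w \<Rightarrow> complex) \<Rightarrow> bool" where
  "complex_gaussian_rv M Z \<longleftrightarrow>
     Z \<in> borel_measurable M \<and>
     (\<forall>a b. gaussian_rv M (\<lambda>\<omega>. a * Re (Z \<omega>) + b * Im (Z \<omega>)))"

definition circular_rv :: "'w measure \<Rightarrow> ('w \<Rightarrow> complex) \<Rightarrow> bool" where
  "circular_rv M Z \<longleftrightarrow>
     Z \<in> borel_measurable M \<and>
     (\<forall>\<theta>. distr M borel (\<lambda>\<omega>. cis \<theta> * Z \<omega>) = distr M borel Z)"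

definition std_circular_gaussian :: "'w measure \<Rightarrow> ('w \<Rightarrow> complex) \<Rightarrow> bool" where
  "std_circular_gaussian M Z \<longleftrightarrow>
     complex_gaussian_rv M Z \<and> circular_rv M Z \<and>
     (LINT \<omega>|M. Z \<omega>) = 0 \<and>
     (LINT \<omega>|M. (cmod (Z \<omega> - (LINT \<omega>'|M. Z \<omega>')))\<^sup>2) = 1"

definition ZMSW :: "'w measure \<Rightarrow> nat \<Rightarrow> nat \<Rightarrow> ('w \<Rightarrow> complex mat) \<Rightarrow> bool" where
  "ZMSW M n m H \<longleftrightarrow>
     H \<in> M \<rightarrow>\<^sub>M borel_mat n m \<and>
     prob_space.indep_vars M (\<lambda>_. borel) (\<lambda>k \<omega>. H \<omega> $$ k) ({..<n} \<times> {..<m}) \<and>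
     (\<forall>k\<in>{..<n} \<times> {..<m}. \<forall>l\<in>{..<n} \<times> {..<m}.
        distr M borel (\<lambda>\<omega>. H \<omega> $$ k) = distr M borel (\<lambda>\<omega>. H \<omega> $$ l)) \<and>
     (\<forall>k\<in>{..<n} \<times> {..<m}. std_circular_gaussian M (\<lambda>\<omega>. H \<omega> $$ k))"

definition unitary_mat :: "nat \<Rightarrow> complex mat \<Rightarrow> bool" where
  "unitary_mat n W \<longleftrightarrow>
     W \<in> carrier_mat n n \<and> mat_adjoint W * W = 1\<^sub>m n \<and> W * mat_adjoint W = 1\<^sub>m n"

definition eigendecomposition :: "nat \<Rightarrow> complex mat \<Rightarrow> complex mat \<Rightarrow> complex mat \<Rightarrow> bool" where
  "eigendecomposition n G W L \<longleftrightarrow>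
     unitary_mat n W \<and> L \<in> carrier_mat n n \<and> diagonal_mat L \<and> G = W * L * mat_adjoint W"

text \<open>Indices are zero-based. Note that \<open>(G *\<^sub>v w) \<bullet>c w\<close> is \<open>w\<^sup>* G w\<close>.\<close>

definition null_selection ::
    "nat \<Rightarrow> nat \<Rightarrow> complex mat \<Rightarrow> complex mat \<Rightarrow> (nat \<Rightarrow> nat) \<Rightarrow> bool" where
  "null_selection n m G W q \<longleftrightarrow>
     inj_on q {..<m} \<and> q ` {..<m} \<subseteq> {..<n} \<and>
     (\<forall>k<m. (G *\<^sub>v col W (q k)) \<bullet>c col W (q k) = 0)"

definition select_cols :: "nat \<Rightarrow> nat \<Rightarrow> complex mat \<Rightarrow> (nat \<Rightarrow> nat) \<Rightarrow> complex mat" where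
  "select_cols n m W q = mat n m (\<lambda>(a, k). W $$ (a, q k))"

text \<open>\<open>T\<close> is the pre-coding matrix of a transmitter with \<open>t\<close> antennas whose channel to the other
  user's receiver, with \<open>r\<close> antennas, is \<open>H\<close>. The functions \<open>W\<close>, \<open>L\<close>, \<open>q\<close> take the Gram matrix
  of \<open>H\<close> as their argument, so that the eigendecomposition and the selected indices depend on that
  matrix only. Their values are constrained only at Gram matrices that actually occur.\<close>

definition precoding :: "'w measure \<Rightarrow> nat \<Rightarrow> nat \<Rightarrow> ('w \<Rightarrow> complex mat) \<Rightarrow> ('w \<Rightarrow> complex mat) \<Rightarrow> bool"
  where
  "precoding M r t H T \<longleftrightarrow>
     (\<exists>(W :: complex mat \<Rightarrow> complex mat) (L :: complex mat \<Rightarrow> complex mat)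
        (q :: complex mat \<Rightarrow> nat \<Rightarrow> nat).
        (\<lambda>G. select_cols t (t - r) (W G) (q G)) \<in> borel_mat t t \<rightarrow>\<^sub>M borel_mat t (t - r) \<and>
        (\<forall>\<omega>\<in>space M.
           let G = mat_adjoint (H \<omega>) * H \<omega> in
             eigendecomposition t G (W G) (L G) \<and>
             null_selection t (t - r) G (W G) (q G) \<and>
             T \<omega> = select_cols t (t - r) (W G) (q G)))"

end

theory Submission
  imports Defs
begin

text \<open>
  A ZMSW matrix \<open>H\<close> satisfies \<open>E exp (\<i> Re (\<Sum>\<^sub>k cnj (w\<^sub>k) H\<^sub>k)) = exp (- \<parallel>w\<parallel>\<^sup>2 / 4)\<close>. The pre-coding
  matrix \<open>T\<close> has orthonormal columns and, being a function of another channel matrix, is independent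
  of \<open>H\<close>. Conditioning on \<open>T\<close> replaces the frequency \<open>w\<close> of \<open>H T\<close> by \<open>w T\<^sup>*\<close>, which has the same norm;
  hence the entries of \<open>H T\<close> have the same joint characteristic function as the first columns of \<open>H\<close>.
  Joint characteristic functions determine joint laws, so \<open>H T\<close> inherits every property of these columns.
\<close>

subsection \<open>Uniqueness for joint characteristic functions\<close>

text \<open>At \<open>t = 0\<close> the hypothesis equates the total masses of the two weights.
  Dividing by this common mass turns \<open>h\<close> and \<open>k\<close> into probability
  densities; the laws of \<open>X\<close> and \<open>Y\<close> under them have equal characteristic
  functions, so Levy's uniqueness theorem applies.\<close>

lemma weighted_char_unique:
  fixes h :: "'a \<Rightarrow> real" and k :: "'b \<Rightarrow> real" and X :: "'a \<Rightarrow> real" and Y :: "'b \<Rightarrow> real"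
  assumes h: "integrable M h" "\<And>x. 0 \<le> h x" and X[measurable]: "X \<in> borel_measurable M"
    and k: "integrable N k" "\<And>x. 0 \<le> k x" and Y[measurable]: "Y \<in> borel_measurable N"
    and eq: "\<And>t. (CLINT x|M. h x * iexp (t * X x)) = (CLINT y|N. k y * iexp (t * Y y))"
    and A[measurable]: "A \<in> sets borel"
  shows "(LINT x|M. h x * indicator A (X x)) = (LINT y|N. k y * indicator A (Y y))"
proof -
  define c where "c = (LINT x|M. h x)"
  have ck: "(LINT y|N. k y) = c"
    using eq[of 0] unfolding c_def by simp
  have c0: "0 \<le> c" unfolding c_def using h(2) by simp
  have [measurable]: "h \<in> borel_measurable M" "k \<in> borel_measurable N" using h k by auto
  show ?thesis
  \<comment> \<open>Zero mass cannot be normalised, but then both nonnegative weights vanish almost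
    everywhere.\<close>
  proof (cases "c = 0")
    case True
    have "AE x in M. h x = 0" using True c_def integral_nonneg_eq_0_iff_AE[OF h(1)] h(2) by simp
    then have "(LINT x|M. h x * indicator A (X x)) = (LINT x|M. 0)"
      by (intro integral_cong_AE) auto
    moreover have "AE x in N. k x = 0" using True ck integral_nonneg_eq_0_iff_AE[OF k(1)] k(2) by simp
    then have "(LINT x|N. k x * indicator A (Y x)) = (LINT x|N. 0)"
      by (intro integral_cong_AE) auto
    ultimately show ?thesis by simp
  next
    case False
    with c0 have c: "c > 0" by simp
    \<comment> \<open>Stated for a generic triple \<open>L\<close>, \<open>g\<close>,
      \<open>Z\<close> with total mass \<open>c\<close>, so that it serves both sides of the
      identity.\<close>
    have step: "real_distribution (distr (density L (\<lambda>x. ennreal (g x / c))) borel Z) \<and>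
       (\<forall>t. char (distr (density L (\<lambda>x. ennreal (g x / c))) borel Z) t = (CLINT x|L. g x * iexp (t * Z x)) / c) \<and>
       measure (distr (density L (\<lambda>x. ennreal (g x / c))) borel Z) A = (LINT x|L. g x * indicator A (Z x)) / c"
      if g: "integrable L g" "\<And>x. 0 \<le> g x" and [measurable]: "Z \<in> borel_measurable L"
        and cg: "(LINT x|L. g x) = c" for L :: "'c measure" and g :: "'c \<Rightarrow> real" and Z
    proof (intro conjI allI)
      have [measurable]: "g \<in> borel_measurable L" using g by auto
      let ?D = "density L (\<lambda>x. ennreal (g x / c))"
      have "emeasure ?D (space ?D) = (\<integral>\<^sup>+x. ennreal (g x / c) \<partial>L)"
        by (simp add: emeasure_density cong: nn_integral_cong)
      also have "\<dots> = ennreal (LINT x|L. g x / c)"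
        using g c by (intro nn_integral_eq_integral) auto
      also have "\<dots> = 1" using cg c by simp
      finally have "emeasure ?D (space ?D) = 1" .
      then interpret D: prob_space ?D by (rule prob_spaceI)
      show rd: "real_distribution (distr ?D borel Z)" by (rule D.real_distribution_distr) simp
      interpret rd: real_distribution "distr ?D borel Z" by (rule rd)
      show "char (distr ?D borel Z) t = (CLINT x|L. g x * iexp (t * Z x)) / c" for t
      proof -
        have "char (distr ?D borel Z) t = (CLINT x|L. (g x / c) *\<^sub>R iexp (t * Z x))"
          unfolding char_def by (simp add: integral_distr integral_density g c0)
        also have "\<dots> = (CLINT x|L. (g x * iexp (t * Z x)) / c)"
          by (simp add: scaleR_conv_of_real)
        also have "\<dots> = (CLINT x|L. g x * iexp (t * Z x)) / c" by (rule integral_divide_zero)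
        finally show ?thesis .
      qed
      have "measure (distr ?D borel Z) A = (LINT x|distr ?D borel Z. indicator A x)" by simp
      also have "\<dots> = (LINT x|L. (g x / c) *\<^sub>R indicator A (Z x))"
        by (subst integral_distr, simp, simp, subst integral_density) (auto simp: g c0)
      also have "\<dots> = (LINT x|L. g x * indicator A (Z x)) / c" by (simp)
      finally show "measure (distr ?D borel Z) A = (LINT x|L. g x * indicator A (Z x)) / c" .
    qed
    note 1 = step[OF h(1) h(2) X c_def[symmetric]] and 2 = step[OF k(1) k(2) Y ck]
    have "distr (density M (\<lambda>x. ennreal (h x / c))) borel X = distr (density N (\<lambda>x. ennreal (k x / c))) borel Y"
      using 1 2 eq by (intro Levy_uniqueness ext) auto
    with 1 2 c show ?thesis by simp
  qed
qed

text \<open>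
  The weights \<open>1 + cos (u + c)\<close> are nonnegative, so the one-dimensional uniqueness theorem, which is
  about positive measures only, applies to them; they recover the oscillating factor \<open>iexp u\<close>.
\<close>

lemma phase_mixture:
  "of_real (1 + cos (u + c)) * z = z + (iexp c * (iexp u * z) + iexp (-c) * (iexp (-u) * z)) / 2"
proof -
  have "of_real (cos t) = (iexp t + iexp (- t)) / 2" for t
    by (simp add: cos_of_real[symmetric] cos_exp_eq)
  then have "of_real (cos (u + c)) = (iexp (u + c) + iexp (- (u + c))) / 2" .
  also have "iexp (u + c) = iexp c * iexp u"
    unfolding exp_add[symmetric] by (simp add: algebra_simps)
  also have "iexp (- (u + c)) = iexp (-c) * iexp (-u)"
    unfolding exp_add[symmetric] by (simp add: algebra_simps)
  finally show ?thesis by (simp add: algebra_simps add_divide_distrib)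
qed

text \<open>\<open>X\<close> is the coordinate to be localised to \<open>A\<close>; \<open>g\<close>
  stands for the product of the indicators already obtained and \<open>u\<close> for the linear form
  in the coordinates still to come. Letting \<open>t\<close> vary identifies the law of
  \<open>X\<close> under the weights \<open>g * (1 + cos (u + c))\<close> and \<open>g\<close>, and
  their difference isolates \<open>cos (u + c)\<close>.\<close>

lemma indicator_for_char:
  fixes g u X :: "'a \<Rightarrow> real" and h v Y :: "'b \<Rightarrow> real"
  assumes "prob_space M" "prob_space N"
    and [measurable]: "g \<in> borel_measurable M" "u \<in> borel_measurable M" "X \<in> borel_measurable M"
    and [measurable]: "h \<in> borel_measurable N" "v \<in> borel_measurable N" "Y \<in> borel_measurable N"
    and g: "\<And>x. 0 \<le> g x" "\<And>x. g x \<le> 1" and h: "\<And>y. 0 \<le> h y" "\<And>y. h y \<le> 1"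
    and eq: "\<And>t a. (CLINT x|M. g x * iexp (t * X x + a * u x)) = (CLINT y|N. h y * iexp (t * Y y + a * v y))"
    and A[measurable]: "A \<in> sets borel"
  shows "(CLINT x|M. of_real (g x * indicator A (X x)) * iexp (u x)) =
         (CLINT y|N. of_real (h y * indicator A (Y y)) * iexp (v y))"
proof -
  interpret M: prob_space M by fact
  interpret N: prob_space N by fact
  have bM: "integrable M f" if "f \<in> borel_measurable M" "\<And>x. norm (f x) \<le> 2" for f :: "'a \<Rightarrow> 'c :: {banach, second_countable_topology}"
    using that by (intro M.integrable_const_bound[of _ 2]) auto
  have bN: "integrable N f" if "f \<in> borel_measurable N" "\<And>x. norm (f x) \<le> 2" for f :: "'b \<Rightarrow> 'c :: {banach, second_countable_topology}"
    using that by (intro N.integrable_const_bound[of _ 2]) auto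
  have m1: "\<bar>p * q\<bar> \<le> 1" if "0 \<le> p" "p \<le> 1" "\<bar>q\<bar> \<le> 1" for p q :: real
    using mult_mono[of "\<bar>p\<bar>" 1 "\<bar>q\<bar>" 1] that by (auto simp: abs_mult)
  have m2: "\<bar>p * (1 + cos q)\<bar> \<le> 2" if "0 \<le> p" "p \<le> 1" for p q :: real
  proof -
    have "0 \<le> 1 + cos q" "1 + cos q \<le> 2" using cos_ge_minus_one[of q] cos_le_one[of q] by linarith+
    with that have "0 \<le> p * (1 + cos q)" "p * (1 + cos q) \<le> 1 * 2" by (intro mult_nonneg_nonneg mult_mono; simp)+
    then show ?thesis by (simp only: abs_of_nonneg)
  qed
  \<comment> \<open>By \<open>phase_mixture\<close>, the cosine weight mixes the multiples
    \<open>a = 0\<close>, \<open>a = 1\<close> and \<open>a = -1\<close> of \<open>w\<close>, each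
    of which is an instance of \<open>eq\<close>.\<close>
  have weight: "(CLINT x|L. complex_of_real (f x * (1 + cos (w x + c))) * iexp (t * Z x)) =
      (CLINT x|L. f x * iexp (t * Z x + 0 * w x)) +
      (iexp c * (CLINT x|L. f x * iexp (t * Z x + 1 * w x)) +
        iexp (-c) * (CLINT x|L. f x * iexp (t * Z x + (-1) * w x))) / 2"
    if "prob_space L" and [measurable]: "f \<in> borel_measurable L" "w \<in> borel_measurable L" "Z \<in> borel_measurable L"
      and f: "\<And>x. 0 \<le> f x" "\<And>x. f x \<le> 1"
    for L :: "'c measure" and f w Z c t
  proof -
    interpret L: prob_space L by fact
    have iexp_int: "integrable L (\<lambda>x. complex_of_real (f x) * iexp (t * Z x + a * w x))" for a
      using f by (intro L.integrable_const_bound[of _ 1]) (auto simp: norm_mult)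
    have iexp_shift: "iexp (t * Z x + b) = iexp b * iexp (t * Z x)" for b x
      by (simp add: distrib_left exp_add)
    have "complex_of_real (f x * (1 + cos (w x + c))) * iexp (t * Z x) =
        f x * iexp (t * Z x + 0 * w x) +
      (iexp c * (f x * iexp (t * Z x + 1 * w x)) +
        iexp (-c) * (f x * iexp (t * Z x + (-1) * w x))) / 2" for x
      using phase_mixture[of "w x" c "f x * iexp (t * Z x)"] unfolding iexp_shift
      by (simp add: mult_ac)
    then show ?thesis
      by (simp only: Bochner_Integration.integral_add integral_mult_right_zero integral_divide_zero
          Bochner_Integration.integrable_add integrable_divide integrable_mult_right iexp_int)
  qed
  have cos_eq: "(LINT x|M. (g x * (1 + cos (u x + c))) * indicator A (X x)) =
      (LINT y|N. (h y * (1 + cos (v y + c))) * indicator A (Y y))" for c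
  proof (rule weighted_char_unique)
    show "integrable M (\<lambda>x. g x * (1 + cos (u x + c)))" using m2 g by (intro bM) auto
    show "integrable N (\<lambda>x. h x * (1 + cos (v x + c)))" using m2 h by (intro bN) auto
    have cc: "0 \<le> 1 + cos q" for q :: real using cos_ge_minus_one[of q] by linarith
    show "0 \<le> g x * (1 + cos (u x + c))" for x using g cc by simp
    show "0 \<le> h x * (1 + cos (v x + c))" for x using h cc by simp
    show "(CLINT x|M. complex_of_real (g x * (1 + cos (u x + c))) * iexp (t * X x)) =
        (CLINT x|N. complex_of_real (h x * (1 + cos (v x + c))) * iexp (t * Y x))" for t
      unfolding weight[OF \<open>prob_space M\<close> assms(3-5) g] weight[OF \<open>prob_space N\<close> assms(6-8) h] eq ..
  qed auto
  have one_eq: "(LINT x|M. g x * indicator A (X x)) = (LINT y|N. h y * indicator A (Y y))"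
    using eq[of _ 0] g h by (intro weighted_char_unique) (auto intro!: bM bN order_trans[OF _ one_le_numeral])
  \<comment> \<open>Subtracting the plain weight \<open>f\<close> removes the 1 that kept the cosine
    weight nonnegative. The shifts \<open>0\<close> and \<open>- (pi/2)\<close> then give cosine and
    sine, the real and imaginary parts of \<open>iexp (w x)\<close>.\<close>
  have cos_int: "(LINT x|L. (f x * (1 + cos (w x + c))) * indicator A (Z x)) - (LINT x|L. f x * indicator A (Z x)) =
       (LINT x|L. (f x * indicator A (Z x)) * cos (w x + c))"
    and iexp_int: "(CLINT x|L. of_real (f x * indicator A (Z x)) * iexp (w x)) =
       of_real (LINT x|L. (f x * indicator A (Z x)) * cos (w x + 0)) +
        \<i> * of_real (LINT x|L. (f x * indicator A (Z x)) * cos (w x + - (pi/2)))"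
    if "prob_space L" and [measurable]: "f \<in> borel_measurable L" "w \<in> borel_measurable L" "Z \<in> borel_measurable L"
      and f: "\<And>x. 0 \<le> f x" "\<And>x. f x \<le> 1"
    for L :: "'c measure" and f w Z c
  proof -
    interpret L: prob_space L by fact
    have i0: "integrable L (\<lambda>x. f x * indicator A (Z x))"
      using f by (intro L.integrable_const_bound[of _ 1]) (auto simp: indicator_def intro!: m1)
    have i1: "integrable L (\<lambda>x. (f x * indicator A (Z x)) * cos (w x + c))" for c
      using f by (intro L.integrable_const_bound[of _ 1]) (auto simp: indicator_def intro!: m1)
    have i2: "integrable L (\<lambda>x. (f x * (1 + cos (w x + c))) * indicator A (Z x))" for c
      using Bochner_Integration.integrable_add[OF i0 i1[of c]] by (simp add: algebra_simps)
    show "(LINT x|L. (f x * (1 + cos (w x + c))) * indicator A (Z x)) - (LINT x|L. f x * indicator A (Z x)) =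
       (LINT x|L. (f x * indicator A (Z x)) * cos (w x + c))"
      by (subst Bochner_Integration.integral_diff[OF i2 i0, symmetric]) (simp add: algebra_simps)
    have "(CLINT x|L. of_real (f x * indicator A (Z x)) * iexp (w x)) =
       (CLINT x|L. of_real ((f x * indicator A (Z x)) * cos (w x + 0)) +
        \<i> * of_real ((f x * indicator A (Z x)) * cos (w x + - (pi/2))))"
      by (intro Bochner_Integration.integral_cong refl)
        (simp add: sin_cos_eq[symmetric] cos_diff exp_Euler cos_of_real sin_of_real algebra_simps)
    also have "\<dots> = of_real (LINT x|L. (f x * indicator A (Z x)) * cos (w x + 0)) +
        \<i> * of_real (LINT x|L. (f x * indicator A (Z x)) * cos (w x + - (pi/2)))"
      using i1[of 0] i1[of "-(pi/2)"]
      by (subst Bochner_Integration.integral_add) (auto simp del: of_real_mult)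
    finally show "(CLINT x|L. of_real (f x * indicator A (Z x)) * iexp (w x)) = \<dots>" .
  qed
  show ?thesis
    unfolding iexp_int[OF \<open>prob_space M\<close> assms(3-5) g] iexp_int[OF \<open>prob_space N\<close> assms(6-8) h]
      cos_int[OF \<open>prob_space M\<close> assms(3-5) g, symmetric] cos_int[OF \<open>prob_space N\<close> assms(6-8) h, symmetric]
      cos_eq one_eq ..
qed

text \<open>
  The induction on \<open>J\<close> replaces the oscillating factors by indicators one coordinate at a time.
\<close>

lemma joint_char_determines_indicators:
  fixes X :: "'i \<Rightarrow> 'a \<Rightarrow> real" and Y :: "'i \<Rightarrow> 'b \<Rightarrow> real"
  assumes "prob_space M" "prob_space N"
    and I: "finite I" "J \<subseteq> I"
    and X: "\<And>i. i \<in> I \<Longrightarrow> X i \<in> borel_measurable M"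
    and Y: "\<And>i. i \<in> I \<Longrightarrow> Y i \<in> borel_measurable N"
    and eq: "\<And>s. (CLINT x|M. iexp (\<Sum>i\<in>I. s i * X i x)) = (CLINT y|N. iexp (\<Sum>i\<in>I. s i * Y i y))"
    and A: "\<And>i. i \<in> I \<Longrightarrow> A i \<in> sets borel"
  shows "(CLINT x|M. of_real (\<Prod>i\<in>J. indicator (A i) (X i x)) * iexp (\<Sum>i\<in>I-J. s i * X i x)) =
         (CLINT y|N. of_real (\<Prod>i\<in>J. indicator (A i) (Y i y)) * iexp (\<Sum>i\<in>I-J. s i * Y i y))"
proof -
  have "finite J" using I by (rule finite_subset[rotated])
  then show ?thesis using I(2)
  proof (induction J arbitrary: s rule: finite_induct)
    case empty
    then show ?case using eq by simp
  next
    case (insert j J)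
    define K where "K = I - insert j J"
    have K: "I - J = insert j K" "j \<notin> K" "finite K" "K \<subseteq> I" "j \<in> I" "J \<subseteq> I"
      using insert I by (auto simp: K_def)
    \<comment> \<open>Frequency \<open>t\<close> at \<open>j\<close> and \<open>a * s i\<close>
      elsewhere yields the two-parameter form \<open>t * X j + a * u\<close> required by
      \<open>indicator_for_char\<close>. The induction hypothesis is available for every frequency
      vector, hence for this one.\<close>
    have split: "(\<Sum>i\<in>I-J. (if i = j then t else a * s i) * z i) = t * z j + a * (\<Sum>i\<in>K. s i * z i)" for t a z
    proof -
      have "(\<Sum>i\<in>K. (if i = j then t else a * s i) * z i) = (\<Sum>i\<in>K. a * (s i * z i))"
        using K(2) by (intro sum.cong) auto
      then show ?thesis using K by (simp add: sum_distrib_left)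
    qed
    have meas: "(\<lambda>x. \<Prod>i\<in>J. indicator (A i) (Z i x) :: real) \<in> borel_measurable L"
        "(\<lambda>x. \<Sum>i\<in>K. s i * Z i x) \<in> borel_measurable L" "Z j \<in> borel_measurable L"
      if "\<And>i. i \<in> I \<Longrightarrow> Z i \<in> borel_measurable L" for L :: "'c measure" and Z :: "'i \<Rightarrow> 'c \<Rightarrow> real"
      using that K(4,5,6) A by (auto intro!: borel_measurable_prod borel_measurable_sum borel_measurable_times
          measurable_compose[OF _ borel_measurable_indicator] simp: subset_iff)
    have bnd: "0 \<le> (\<Prod>i\<in>J. indicator (A i) (z i) :: real)" "(\<Prod>i\<in>J. indicator (A i) (z i) :: real) \<le> 1" for z
      by (auto intro!: prod_nonneg prod_le_1 simp: indicator_def)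
    have "(CLINT x|M. of_real ((\<Prod>i\<in>J. indicator (A i) (X i x)) * indicator (A j) (X j x)) * iexp (\<Sum>i\<in>K. s i * X i x)) =
          (CLINT y|N. of_real ((\<Prod>i\<in>J. indicator (A i) (Y i y)) * indicator (A j) (Y j y)) * iexp (\<Sum>i\<in>K. s i * Y i y))"
      using insert.IH[OF K(6), of "\<lambda>i. if i = j then _ else _ * s i", unfolded split] A K(5)
      by (intro indicator_for_char[OF assms(1,2) meas[OF X] meas[OF Y]] bnd) auto
    then show ?case using insert.hyps
      by (simp add: K_def mult.commute)
  qed
qed

text \<open>With \<open>J = I\<close> no oscillating factor is left, so the two laws agree on
  measurable boxes, which are closed under intersection and generate the product
  sigma-algebra.\<close>

lemma distr_PiM_eq_of_joint_char:
  fixes X :: "'i \<Rightarrow> 'a \<Rightarrow> real" and Y :: "'i \<Rightarrow> 'b \<Rightarrow> real"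
  assumes "prob_space M" "prob_space N" and I: "finite I"
    and X: "\<And>i. i \<in> I \<Longrightarrow> X i \<in> borel_measurable M"
    and Y: "\<And>i. i \<in> I \<Longrightarrow> Y i \<in> borel_measurable N"
    and eq: "\<And>s. (CLINT x|M. iexp (\<Sum>i\<in>I. s i * X i x)) = (CLINT y|N. iexp (\<Sum>i\<in>I. s i * Y i y))"
  shows "distr M (\<Pi>\<^sub>M i\<in>I. borel) (\<lambda>x. \<lambda>i\<in>I. X i x) = distr N (\<Pi>\<^sub>M i\<in>I. borel) (\<lambda>y. \<lambda>i\<in>I. Y i y)"
proof (rule measure_eqI_PiM_finite[OF I])
  \<comment> \<open>The measure of a box is the expectation of a product of indicators; it is
    written as the real part of a complex integral to match
    \<open>joint_char_determines_indicators\<close>.\<close>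
  have em: "emeasure (distr L (\<Pi>\<^sub>M i\<in>I. borel) (\<lambda>x. \<lambda>i\<in>I. Z i x)) (Pi\<^sub>E I A) =
      ennreal (Re (CLINT x|L. of_real (\<Prod>i\<in>I. indicator (A i) (Z i x))))"
    if "prob_space L" and Z: "\<And>i. i \<in> I \<Longrightarrow> Z i \<in> borel_measurable L" and A: "\<And>i. i \<in> I \<Longrightarrow> A i \<in> sets borel"
    for L :: "'c measure" and Z :: "'i \<Rightarrow> 'c \<Rightarrow> real" and A
  proof -
    interpret prob_space L by fact
    let ?S = "(\<lambda>x. \<lambda>i\<in>I. Z i x) -` (Pi\<^sub>E I A) \<inter> space L"
    have m: "(\<lambda>x. \<lambda>i\<in>I. Z i x) \<in> L \<rightarrow>\<^sub>M (\<Pi>\<^sub>M i\<in>I. borel)" using Z by (intro measurable_restrict) auto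
    have P: "Pi\<^sub>E I A \<in> sets (\<Pi>\<^sub>M i\<in>I. borel)" using A I by (intro sets_PiM_I_finite) auto
    have "emeasure (distr L (\<Pi>\<^sub>M i\<in>I. borel) (\<lambda>x. \<lambda>i\<in>I. Z i x)) (Pi\<^sub>E I A) = emeasure L ?S"
      by (rule emeasure_distr[OF m P])
    also have "\<dots> = ennreal (measure L ?S)" by (rule emeasure_eq_measure)
    also have "measure L ?S = (LINT x|L. indicator ?S x)" using measurable_sets[OF m P] by simp
    also have "\<dots> = (LINT x|L. (\<Prod>i\<in>I. indicator (A i) (Z i x)))"
      using I by (intro Bochner_Integration.integral_cong refl)
        (auto simp: indicator_def prod_zero_iff restrict_PiE_iff intro!: prod.neutral)
    also have "\<dots> = Re (CLINT x|L. of_real (\<Prod>i\<in>I. indicator (A i) (Z i x)))"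
      by (simp del: of_real_prod)
    finally show ?thesis .
  qed
  show "emeasure (distr M (\<Pi>\<^sub>M i\<in>I. borel) (\<lambda>x. \<lambda>i\<in>I. X i x)) (Pi\<^sub>E I A) =
     emeasure (distr N (\<Pi>\<^sub>M i\<in>I. borel) (\<lambda>y. \<lambda>i\<in>I. Y i y)) (Pi\<^sub>E I A)"
    if "\<And>i. i \<in> I \<Longrightarrow> A i \<in> sets borel" for A
    using em[OF assms(1) X that] em[OF assms(2) Y that]
      joint_char_determines_indicators[OF assms(1,2) I subset_refl X Y eq that]
    by simp
  have "(\<lambda>x. \<lambda>i\<in>I. X i x) \<in> M \<rightarrow>\<^sub>M (\<Pi>\<^sub>M i\<in>I. borel)" using X by (intro measurable_restrict) auto
  then interpret D: prob_space "distr M (\<Pi>\<^sub>M i\<in>I. borel) (\<lambda>x. \<lambda>i\<in>I. X i x)"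
    by (rule prob_space.prob_space_distr[OF assms(1)])
  \<comment> \<open>The whole space is itself a box of finite measure, so a constant sequence
    exhausts it.\<close>
  show "range (\<lambda>_::nat. Pi\<^sub>E I (\<lambda>_. UNIV)) \<subseteq> prod_algebra I (\<lambda>_. borel)"
    using I by (auto intro!: prod_algebraI_finite)
  show "(\<Union>i::nat. Pi\<^sub>E I (\<lambda>_. UNIV)) = space (\<Pi>\<^sub>M i\<in>I. borel)" by (simp add: space_PiM)
  show "emeasure (distr M (\<Pi>\<^sub>M i\<in>I. borel) (\<lambda>x. \<lambda>i\<in>I. X i x)) (Pi\<^sub>E I (\<lambda>_. UNIV)) \<noteq> \<infinity>"
    using D.emeasure_finite by simp
qed auto

text \<open>Each complex coordinate is split into real and imaginary part, indexed by
  \<open>K \<times> UNIV\<close>. Since \<open>Re (cnj w * z)\<close> is the Euclidean inner product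
  of \<open>w\<close> and \<open>z\<close> in the plane, one complex frequency encodes a pair of
  real ones.\<close>

lemma distr_PiM_eq_of_joint_char_complex:
  fixes Z :: "'k \<Rightarrow> 'a \<Rightarrow> complex" and V :: "'k \<Rightarrow> 'b \<Rightarrow> complex"
  assumes "prob_space M" "prob_space N" and K: "finite K"
    and Z: "\<And>k. k \<in> K \<Longrightarrow> Z k \<in> borel_measurable M"
    and V: "\<And>k. k \<in> K \<Longrightarrow> V k \<in> borel_measurable N"
    and eq: "\<And>w. (CLINT x|M. iexp (Re (\<Sum>k\<in>K. cnj (w k) * Z k x))) = (CLINT y|N. iexp (Re (\<Sum>k\<in>K. cnj (w k) * V k y)))"
  shows "distr M (\<Pi>\<^sub>M k\<in>K. borel) (\<lambda>x. \<lambda>k\<in>K. Z k x) = distr N (\<Pi>\<^sub>M k\<in>K. borel) (\<lambda>y. \<lambda>k\<in>K. V k y)"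
proof -
  define I where "I = K \<times> (UNIV :: bool set)"
  define part where "part = (\<lambda>(b::bool) z. if b then Re z else Im z)"
  define \<Phi> where "\<Phi> = (\<lambda>f. \<lambda>k\<in>K. complex_of_real (f (k, True)) + \<i> * complex_of_real (f (k, False)))"
  have [measurable]: "part b \<in> borel_measurable borel" for b by (cases b) (auto simp: part_def)
  have \<Phi>: "\<Phi> \<in> (\<Pi>\<^sub>M i\<in>I. borel) \<rightarrow>\<^sub>M (\<Pi>\<^sub>M k\<in>K. borel)"
    unfolding \<Phi>_def I_def by (intro measurable_restrict) measurable
  \<comment> \<open>\<open>\<Phi>\<close> reassembles complex numbers from their parts, so the
    complex law is the image of the real one and equality of the real laws suffices.\<close>
  have map: "distr L (\<Pi>\<^sub>M k\<in>K. borel) (\<lambda>x. \<lambda>k\<in>K. U k x) =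
      distr (distr L (\<Pi>\<^sub>M i\<in>I. borel) (\<lambda>x. \<lambda>i\<in>I. part (snd i) (U (fst i) x))) (\<Pi>\<^sub>M k\<in>K. borel) \<Phi>"
    if "\<And>k. k \<in> K \<Longrightarrow> U k \<in> borel_measurable L" for L :: "'c measure" and U :: "'k \<Rightarrow> 'c \<Rightarrow> complex"
  proof -
    have m: "(\<lambda>x. \<lambda>i\<in>I. part (snd i) (U (fst i) x)) \<in> L \<rightarrow>\<^sub>M (\<Pi>\<^sub>M i\<in>I. borel)"
      using that by (intro measurable_restrict measurable_compose[OF _ \<open>part _ \<in> _\<close>]) (auto simp: I_def)
    show "distr L (\<Pi>\<^sub>M k\<in>K. borel) (\<lambda>x. \<lambda>k\<in>K. U k x) =
      distr (distr L (\<Pi>\<^sub>M i\<in>I. borel) (\<lambda>x. \<lambda>i\<in>I. part (snd i) (U (fst i) x))) (\<Pi>\<^sub>M k\<in>K. borel) \<Phi>"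
      unfolding distr_distr[OF \<Phi> m]
      by (intro distr_cong refl) (auto simp: \<Phi>_def part_def I_def complex_eq_iff intro!: restrict_ext)
  qed
  have sum: "(\<Sum>i\<in>I. s i * part (snd i) (U (fst i) x)) =
      Re (\<Sum>k\<in>K. cnj (Complex (s (k, True)) (s (k, False))) * U k x)" for s and U :: "'k \<Rightarrow> 'c \<Rightarrow> complex" and x
  proof -
    have "(\<Sum>i\<in>I. s i * part (snd i) (U (fst i) x)) = (\<Sum>k\<in>K. \<Sum>b\<in>UNIV. s (k, b) * part b (U k x))"
      unfolding I_def by (subst sum.cartesian_product) (simp add: case_prod_beta)
    then show ?thesis by (simp add: UNIV_bool part_def add.commute)
  qed
  have "distr M (\<Pi>\<^sub>M i\<in>I. borel) (\<lambda>x. \<lambda>i\<in>I. part (snd i) (Z (fst i) x)) =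
      distr N (\<Pi>\<^sub>M i\<in>I. borel) (\<lambda>x. \<lambda>i\<in>I. part (snd i) (V (fst i) x))"
  proof (rule distr_PiM_eq_of_joint_char[OF assms(1,2)])
    show "finite I" using K by (simp add: I_def)
    show "(\<lambda>x. part (snd i) (Z (fst i) x)) \<in> borel_measurable M" if "i \<in> I" for i
      using that Z by (intro measurable_compose[OF _ \<open>part _ \<in> _\<close>]) (auto simp: I_def)
    show "(\<lambda>x. part (snd i) (V (fst i) x)) \<in> borel_measurable N" if "i \<in> I" for i
      using that V by (intro measurable_compose[OF _ \<open>part _ \<in> _\<close>]) (auto simp: I_def)
  qed (unfold sum, rule eq)
  then show ?thesis using map[OF Z] map[OF V] by simp
qed

subsection \<open>Circular Gaussian variables\<close>

lemma (in prob_space) normal_iexp_expectation: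
  assumes "distributed M lborel X (normal_density 0 \<sigma>)" "0 < \<sigma>"
  shows "(CLINT x|M. iexp (t * X x)) = of_real (exp (- (t\<^sup>2 * \<sigma>\<^sup>2) / 2))"
proof -
  have D: "distributed M lborel (\<lambda>x. X x / \<sigma>) std_normal_density"
    using assms normal_standard_normal_convert[of \<sigma> X 0] by simp
  then have [measurable]: "(\<lambda>x. X x / \<sigma>) \<in> borel_measurable M" by (auto dest: distributed_measurable)
  have "(CLINT x|M. iexp (t * X x)) = (CLINT x|M. iexp ((t * \<sigma>) * (X x / \<sigma>)))"
    using assms(2) by simp
  also have "\<dots> = (CLINT x|distr M lborel (\<lambda>x. X x / \<sigma>). iexp ((t * \<sigma>) * x))"
    by (subst integral_distr) auto
  also have "\<dots> = char std_normal_distribution (t * \<sigma>)"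
    unfolding distributed_distr_eq_density[OF D] char_def ..
  also have "\<dots> = of_real (exp (- (t\<^sup>2 * \<sigma>\<^sup>2) / 2))"
    by (simp add: char_std_normal_distribution power_mult_distrib)
  finally show ?thesis .
qed

text \<open>Rotation invariance acts twice. It gives \<open>Re Z\<close> and \<open>Im Z\<close> the
  same second moment, hence \<open>1/2\<close> each, so that \<open>Re Z\<close> is normal with
  variance \<open>1/2\<close>; and it replaces \<open>Re (cnj w * Z)\<close> by
  \<open>cmod w * Re Z\<close>.\<close>

lemma (in prob_space) std_circular_gaussian_char:
  assumes "std_circular_gaussian M Z"
  shows "(CLINT x|M. iexp (Re (cnj w * Z x))) = of_real (exp (- (cmod w)\<^sup>2 / 4))"
proof -
  have Z[measurable]: "Z \<in> borel_measurable M"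
    and all_gauss: "\<And>a b. gaussian_rv M (\<lambda>x. a * Re (Z x) + b * Im (Z x))"
    and mean: "expectation Z = 0" and var: "expectation (\<lambda>x. (cmod (Z x))\<^sup>2) = 1"
    using assms by (auto simp: std_circular_gaussian_def complex_gaussian_rv_def)
  have gauss: "gaussian_rv M (\<lambda>x. Re (Z x))" using all_gauss[of 1 0] by simp
  have rot: "expectation (\<lambda>x. f (cis \<theta> * Z x)) = expectation (\<lambda>x. f (Z x))"
    if [measurable]: "f \<in> borel_measurable borel" for f :: "complex \<Rightarrow> 'b :: {banach, second_countable_topology}" and \<theta>
  proof -
    have "distr M borel (\<lambda>x. cis \<theta> * Z x) = distr M borel Z"
      using assms by (auto simp: std_circular_gaussian_def circular_rv_def)
    then have "integral\<^sup>L (distr M borel (\<lambda>x. cis \<theta> * Z x)) f = integral\<^sup>L (distr M borel Z) f" by simp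
    then show ?thesis by (simp add: integral_distr)
  qed
  \<comment> \<open>A non-integrable function has integral 0 by convention, so the value 1 forces
    integrability.\<close>
  have sq: "integrable M (\<lambda>x. (cmod (Z x))\<^sup>2)"
    using var not_integrable_integral_eq by fastforce
  have intZ: "integrable M Z"
  proof (rule Bochner_Integration.integrable_bound)
    show "integrable M (\<lambda>x. 1 + (cmod (Z x))\<^sup>2)" using sq by simp
    show "AE x in M. norm (Z x) \<le> norm (1 + (cmod (Z x))\<^sup>2)"
    proof (rule AE_I2)
      fix x
      have "2 * cmod (Z x) \<le> 1 + (cmod (Z x))\<^sup>2" using sum_squares_bound[of 1 "cmod (Z x)"] by simp
      then have "cmod (Z x) \<le> 1 + (cmod (Z x))\<^sup>2" using norm_ge_zero[of "Z x"] by linarith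
      then show "norm (Z x) \<le> norm (1 + (cmod (Z x))\<^sup>2)" by simp
    qed
  qed simp
  have sqRe: "integrable M (\<lambda>x. (Re (Z x))\<^sup>2)" and sqIm: "integrable M (\<lambda>x. (Im (Z x))\<^sup>2)"
    by (auto intro!: Bochner_Integration.integrable_bound[OF sq] simp: cmod_power2)
  \<comment> \<open>The rotation by \<open>pi/2\<close> is multiplication by \<open>\<i>\<close>,
    which carries \<open>Im Z\<close> to the real part up to sign.\<close>
  have "expectation (\<lambda>x. (Re (Z x))\<^sup>2) = expectation (\<lambda>x. (Im (Z x))\<^sup>2)"
    using rot[of "\<lambda>z. (Re z)\<^sup>2" "pi/2"] by simp
  moreover have "expectation (\<lambda>x. (Re (Z x))\<^sup>2) + expectation (\<lambda>x. (Im (Z x))\<^sup>2) = 1"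
    using var by (simp add: cmod_power2 sqRe sqIm)
  ultimately have half: "expectation (\<lambda>x. (Re (Z x))\<^sup>2) = 1/2" by simp
  have Re0: "expectation (\<lambda>x. Re (Z x)) = 0" using mean intZ by (simp add: integral_Re)
  \<comment> \<open>The degenerate alternative of \<open>gaussian_rv\<close> is excluded: a constant
    with mean 0 has second moment 0 rather than \<open>1/2\<close>.\<close>
  obtain \<mu> \<sigma> where \<sigma>: "\<sigma> > 0" and D: "distributed M lborel (\<lambda>x. Re (Z x)) (normal_density \<mu> \<sigma>)"
  proof -
    have False if "AE x in M. Re (Z x) = \<mu>" for \<mu>
    proof -
      have "expectation (\<lambda>x. Re (Z x)) = expectation (\<lambda>x. \<mu>)"
        using that by (intro integral_cong_AE) auto
      then have "\<mu> = 0" using Re0 by (simp add: prob_space)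
      have "expectation (\<lambda>x. (Re (Z x))\<^sup>2) = expectation (\<lambda>x. \<mu>\<^sup>2)"
        using that by (intro integral_cong_AE) auto
      then show False using half \<open>\<mu> = 0\<close> by simp
    qed
    then show ?thesis using gauss that by (auto simp: gaussian_rv_def)
  qed
  have "\<mu> = 0" using normal_distributed_expectation[OF \<sigma> D] Re0 by simp
  moreover have "\<sigma>\<^sup>2 = 1/2" using normal_distributed_variance[OF \<sigma> D] Re0 half by simp
  ultimately have re: "(CLINT x|M. iexp (s * Re (Z x))) = of_real (exp (- s\<^sup>2 / 4))" for s
    using normal_iexp_expectation[OF _ \<sigma>, of "\<lambda>x. Re (Z x)" s] D by simp
  obtain \<theta> where \<theta>: "cnj w = of_real (cmod w) * cis \<theta>"
    using rcis_cmod_Arg[of "cnj w"] unfolding rcis_def by (metis complex_mod_cnj)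
  have "(CLINT x|M. iexp (Re (cnj w * Z x))) = (CLINT x|M. iexp (cmod w * Re (cis \<theta> * Z x)))"
    by (simp add: \<theta> mult.assoc right_diff_distrib)
  also have "\<dots> = (CLINT x|M. iexp (cmod w * Re (Z x)))"
    by (rule rot) measurable
  finally show ?thesis using re by simp
qed

text \<open>Independence factors the expectation into one-variable values. The result sees
  \<open>w\<close> only through its Euclidean norm, which is the invariance that an isometry
  exploits.\<close>

lemma (in prob_space) indep_std_circular_gaussian_char:
  assumes K: "finite K" and ind: "indep_vars (\<lambda>_. borel) Z K"
    and Z: "\<And>k. k \<in> K \<Longrightarrow> std_circular_gaussian M (Z k)"
  shows "(CLINT x|M. iexp (Re (\<Sum>k\<in>K. cnj (w k) * Z k x))) =
    of_real (exp (- (\<Sum>k\<in>K. (cmod (w k))\<^sup>2) / 4))"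
proof -
  have [measurable]: "Z k \<in> borel_measurable M" if "k \<in> K" for k
    using Z[OF that] by (simp add: std_circular_gaussian_def circular_rv_def)
  have "(CLINT x|M. iexp (Re (\<Sum>k\<in>K. cnj (w k) * Z k x))) =
      (CLINT x|M. (\<Prod>k\<in>K. iexp (Re (cnj (w k) * Z k x))))"
    using K by (simp only: Re_sum of_real_sum sum_distrib_left exp_sum)
  also have "\<dots> = (\<Prod>k\<in>K. CLINT x|M. iexp (Re (cnj (w k) * Z k x)))"
  proof (rule indep_vars_lebesgue_integral[OF K])
    show "indep_vars (\<lambda>_. borel) (\<lambda>k x. iexp (Re (cnj (w k) * Z k x))) K"
      by (rule indep_vars_compose2[OF ind]) measurable
    show "integrable M (\<lambda>x. iexp (Re (cnj (w k) * Z k x)))" if "k \<in> K" for k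
      using that by (intro integrable_iexp) auto
  qed
  also have "\<dots> = of_real (\<Prod>k\<in>K. exp (- (cmod (w k))\<^sup>2 / 4))"
    unfolding of_real_prod by (intro prod.cong refl std_circular_gaussian_char Z)
  also have "\<dots> = of_real (exp (- (\<Sum>k\<in>K. (cmod (w k))\<^sup>2) / 4))"
    using K by (simp add: exp_sum[symmetric] sum_negf sum_divide_distrib)
  finally show ?thesis .
qed

lemma gaussian_rv_distr:
  assumes [measurable]: "Z \<in> borel_measurable M" "g \<in> borel_measurable borel"
  shows "gaussian_rv (distr M borel Z) g \<longleftrightarrow> gaussian_rv M (\<lambda>\<omega>. g (Z \<omega>))"
proof -
  have "distr (distr M borel Z) lborel g = distr M lborel (\<lambda>\<omega>. g (Z \<omega>))"
    by (subst distr_distr) (auto simp: comp_def)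
  moreover have "(AE x in distr M borel Z. g x = \<mu>) \<longleftrightarrow> (AE \<omega> in M. g (Z \<omega>) = \<mu>)" for \<mu>
    by (rule AE_distr_iff) measurable
  ultimately show ?thesis by (simp add: gaussian_rv_def distributed_def)
qed

text \<open>Every clause of the definition depends on the law of \<open>Z\<close> alone. Hence two
  entries with equal laws share the property, which is how it passes from \<open>H\<close> to
  \<open>H T\<close>.\<close>

lemma std_circular_gaussian_distr:
  assumes [measurable]: "Z \<in> borel_measurable M"
  shows "std_circular_gaussian (distr M borel Z) (\<lambda>z. z) \<longleftrightarrow> std_circular_gaussian M Z"
proof -
  have "distr (distr M borel Z) borel (\<lambda>z. cis \<theta> * z) = distr M borel (\<lambda>\<omega>. cis \<theta> * Z \<omega>)" for \<theta>
    by (subst distr_distr) (auto simp: comp_def)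
  moreover have "distr (distr M borel Z) borel (\<lambda>z. z) = distr M borel Z"
    by (subst distr_distr) (auto simp: comp_def)
  ultimately show ?thesis
    by (simp add: std_circular_gaussian_def complex_gaussian_rv_def circular_rv_def integral_distr
        gaussian_rv_distr[of Z M "\<lambda>z. a * Re z + b * Im z" for a b])
qed

subsection \<open>Random matrices\<close>

lemma space_borel_mat [simp]: "space (borel_mat n m) = carrier_mat n m"
  by (simp add: borel_mat_def)

lemma measurable_borel_matI:
  assumes "\<And>x. x \<in> space M \<Longrightarrow> f x \<in> carrier_mat n m"
    and "\<And>i j. i < n \<Longrightarrow> j < m \<Longrightarrow> (\<lambda>x. f x $$ (i, j)) \<in> borel_measurable M"
  shows "f \<in> M \<rightarrow>\<^sub>M borel_mat n m"
  unfolding borel_mat_def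
proof (rule measurable_vimage_algebra2)
  show "f \<in> space M \<rightarrow> carrier_mat n m" using assms(1) by auto
  show "(\<lambda>x. \<lambda>k\<in>{..<n} \<times> {..<m}. f x $$ k) \<in> M \<rightarrow>\<^sub>M (\<Pi>\<^sub>M k\<in>{..<n} \<times> {..<m}. borel)"
    using assms(2) by (intro measurable_restrict) auto
qed

lemma measurable_mat_entry:
  assumes f: "f \<in> M \<rightarrow>\<^sub>M borel_mat n m" and k: "i < n" "j < m"
  shows "(\<lambda>x. f x $$ (i, j)) \<in> borel_measurable M"
proof -
  have "(\<lambda>A. \<lambda>k\<in>{..<n} \<times> {..<m}. A $$ k) \<in> borel_mat n m \<rightarrow>\<^sub>M (\<Pi>\<^sub>M k\<in>{..<n} \<times> {..<m}. (borel :: complex measure))"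
    unfolding borel_mat_def by (rule measurable_vimage_algebra1) (auto simp: space_PiM)
  from measurable_compose[OF f measurable_compose[OF this measurable_component_singleton[of "(i, j)"]]]
  show ?thesis using k by simp
qed

lemma mat_adjoint_carrier: "A \<in> carrier_mat n m \<Longrightarrow> mat_adjoint A \<in> carrier_mat m n"
  by (auto simp: mat_adjoint_def)

lemma index_gram:
  fixes A :: "complex mat"
  assumes "A \<in> carrier_mat n m" "i < m" "j < m"
  shows "(mat_adjoint A * A) $$ (i, j) = (\<Sum>k<n. cnj (A $$ (k, i)) * A $$ (k, j))"
  using assms
  by (auto simp: mat_adjoint_def mat_of_rows_index scalar_prod_def conjugate_vec_def atLeast0LessThan
      intro!: sum.cong)

text \<open>The Gram entries are polynomials in the matrix entries and their conjugates. This makes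
  the pre-coder, given as a measurable function of the Gram matrix, a measurable function of the
  channel itself.\<close>

lemma measurable_gram: "(\<lambda>A. mat_adjoint A * A) \<in> borel_mat n m \<rightarrow>\<^sub>M borel_mat m m"
proof (rule measurable_borel_matI)
  show "mat_adjoint A * A \<in> carrier_mat m m" if "A \<in> space (borel_mat n m)" for A
    using that mat_adjoint_carrier[of A n m] by auto
  show "(\<lambda>A. (mat_adjoint A * A) $$ (i, j)) \<in> borel_measurable (borel_mat n m)" if "i < m" "j < m" for i j
  proof -
    have cnj: "cnj \<in> borel_measurable borel"
      by (intro borel_measurable_continuous_onI continuous_intros)
    have entry: "(\<lambda>A. A $$ (k, l)) \<in> borel_measurable (borel_mat n m)" if "k < n" "l < m" for k l
      using measurable_mat_entry[OF measurable_ident that] by simp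
    have "(\<lambda>A. \<Sum>k<n. cnj (A $$ (k, i)) * A $$ (k, j)) \<in> borel_measurable (borel_mat n m)"
      using that by (intro borel_measurable_sum borel_measurable_times measurable_compose[OF entry cnj] entry) auto
    then show ?thesis
      by (rule measurable_cong[THEN iffD1, rotated]) (use that index_gram in auto)
  qed
qed

lemma index_mult_sum:
  assumes "A \<in> carrier_mat n t" "B \<in> carrier_mat t m" "i < n" "j < m"
  shows "(A * B) $$ (i, j) = (\<Sum>c<t. A $$ (i, c) * B $$ (c, j))"
  using assms by (auto simp: scalar_prod_def atLeast0LessThan intro!: sum.cong)

section \<open>Matrices with orthonormal columns\<close>

text \<open>Entry \<open>(i, j)\<close> of this product is entry \<open>(q i, q j)\<close> of
  \<open>mat_adjoint W * W\<close>, and injectivity of \<open>q\<close> keeps off-diagonal positions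
  off the diagonal.\<close>

lemma gram_select_cols:
  assumes W: "unitary_mat t W" and q: "inj_on q {..<m}" "q ` {..<m} \<subseteq> {..<t}"
  shows "mat_adjoint (select_cols t m W q) * select_cols t m W q = 1\<^sub>m m"
proof (rule eq_matI)
  have S: "select_cols t m W q \<in> carrier_mat t m" by (simp add: select_cols_def)
  note SS = mat_adjoint_carrier[OF S]
  show "dim_row (mat_adjoint (select_cols t m W q) * select_cols t m W q) = dim_row (1\<^sub>m m)"
    "dim_col (mat_adjoint (select_cols t m W q) * select_cols t m W q) = dim_col (1\<^sub>m m)"
    using S SS by auto
  fix i j assume ij: "i < dim_row (1\<^sub>m m)" "j < dim_col (1\<^sub>m m)"
  then have l: "i < m" "j < m" "q i < t" "q j < t" using q by auto
  have W1: "W \<in> carrier_mat t t" "mat_adjoint W * W = 1\<^sub>m t" using W by (auto simp: unitary_mat_def)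
  have "(mat_adjoint (select_cols t m W q) * select_cols t m W q) $$ (i, j) =
      (\<Sum>k<t. cnj (W $$ (k, q i)) * W $$ (k, q j))"
    unfolding index_gram[OF S l(1,2)] using l by (simp add: select_cols_def)
  also have "\<dots> = 1\<^sub>m t $$ (q i, q j)" using index_gram[OF W1(1) l(3,4)] W1(2) by simp
  also have "\<dots> = 1\<^sub>m m $$ (i, j)" using l q(1) by (auto simp: inj_on_eq_iff)
  finally show "(mat_adjoint (select_cols t m W q) * select_cols t m W q) $$ (i, j) = 1\<^sub>m m $$ (i, j)" .
qed

text \<open>The inner sums are the entries of the row vector \<open>w T\<^sup>*\<close>. Expanding
  the squares and summing over \<open>c\<close> first produces the entries of
  \<open>T\<^sup>* T\<close>, so only the diagonal terms survive.\<close>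

lemma isometry_preserves_norm:
  fixes w :: "nat \<Rightarrow> complex"
  assumes T: "T \<in> carrier_mat t m" and iso: "mat_adjoint T * T = 1\<^sub>m m"
  shows "(\<Sum>c<t. (cmod (\<Sum>b<m. w b * cnj (T $$ (c, b))))\<^sup>2) = (\<Sum>b<m. (cmod (w b))\<^sup>2)"
proof -
  have orth: "(\<Sum>c<t. cnj (T $$ (c, b)) * T $$ (c, b')) = (if b = b' then 1 else 0)" if "b < m" "b' < m" for b b'
    using index_gram[OF T that] that iso by simp
  have "complex_of_real (\<Sum>c<t. (cmod (\<Sum>b<m. w b * cnj (T $$ (c, b))))\<^sup>2) =
      (\<Sum>c<t. \<Sum>b<m. \<Sum>b'<m. w b * cnj (w b') * (cnj (T $$ (c, b)) * T $$ (c, b')))"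
    by (simp add: complex_norm_square sum_product ac_simps del: of_real_power)
  also have "\<dots> = (\<Sum>b<m. \<Sum>b'<m. w b * cnj (w b') * (\<Sum>c<t. cnj (T $$ (c, b)) * T $$ (c, b')))"
    unfolding sum_distrib_left by (subst sum.swap, intro sum.cong refl sum.swap)
  also have "\<dots> = (\<Sum>b<m. \<Sum>b'<m. if b' = b then w b * cnj (w b') else 0)"
    by (intro sum.cong refl) (auto simp: orth)
  also have "\<dots> = complex_of_real (\<Sum>b<m. (cmod (w b))\<^sup>2)"
    by (simp add: complex_norm_square del: of_real_power)
  finally show ?thesis by (simp only: of_real_eq_iff)
qed

section \<open>Multiplication by an independent random isometry\<close>

text \<open>The object of comparison is the block of the first \<open>m\<close> columns of
  \<open>H\<close>, which exists because \<open>m \<le> t\<close>. Its entries and those of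
  \<open>H T\<close> have the same joint law, and this transports independence and the
  marginals.\<close>

lemma (in prob_space) ZMSW_mult_isometry:
  assumes H: "ZMSW M n t H" and T: "T \<in> M \<rightarrow>\<^sub>M borel_mat t m"
    and ind: "indep_var (borel_mat n t) H (borel_mat t m) T"
    and iso: "\<And>\<omega>. \<omega> \<in> space M \<Longrightarrow> mat_adjoint (T \<omega>) * T \<omega> = 1\<^sub>m m"
    and mt: "m \<le> t"
  shows "ZMSW M n m (\<lambda>\<omega>. H \<omega> * T \<omega>)"
proof -
  let ?K = "{..<n} \<times> {..<m}" and ?Kt = "{..<n} \<times> {..<t}"
  have Hm: "H \<in> M \<rightarrow>\<^sub>M borel_mat n t"
    and Hind: "indep_vars (\<lambda>_. borel) (\<lambda>k \<omega>. H \<omega> $$ k) ?Kt"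
    and Hstd: "\<And>k. k \<in> ?Kt \<Longrightarrow> std_circular_gaussian M (\<lambda>\<omega>. H \<omega> $$ k)"
    and Hid: "\<And>k l. k \<in> ?Kt \<Longrightarrow> l \<in> ?Kt \<Longrightarrow> distr M borel (\<lambda>\<omega>. H \<omega> $$ k) = distr M borel (\<lambda>\<omega>. H \<omega> $$ l)"
    using H unfolding ZMSW_def by blast+
  have Hc: "H \<omega> \<in> carrier_mat n t" and Tc: "T \<omega> \<in> carrier_mat t m" if "\<omega> \<in> space M" for \<omega>
    using measurable_space[OF Hm that] measurable_space[OF T that] by auto
  have sub: "?K \<subseteq> ?Kt" using mt by auto
  \<comment> \<open>For a fixed isometry \<open>A\<close>, pairing \<open>w\<close> with
    \<open>H A\<close> is pairing \<open>v = w A\<^sup>*\<close> with \<open>H\<close>. Row by row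
    \<open>v\<close> has the norm of \<open>w\<close>, so the value does not depend on
    \<open>A\<close>.\<close>
  have char_given: "(CLINT x|M. iexp (Re (\<Sum>(a, b)\<in>?K. cnj (w (a, b)) * (\<Sum>c<t. H x $$ (a, c) * A $$ (c, b))))) =
      of_real (exp (- (\<Sum>k\<in>?K. (cmod (w k))\<^sup>2) / 4))"
    if A: "A \<in> carrier_mat t m" "mat_adjoint A * A = 1\<^sub>m m" for A w
  proof -
    define v where "v = (\<lambda>(a, c). \<Sum>b<m. w (a, b) * cnj (A $$ (c, b)))"
    have "(\<Sum>(a, b)\<in>?K. cnj (w (a, b)) * (\<Sum>c<t. h $$ (a, c) * A $$ (c, b))) = (\<Sum>k\<in>?Kt. cnj (v k) * h $$ k)" for h
    proof -
      have "(\<Sum>(a, b)\<in>?K. cnj (w (a, b)) * (\<Sum>c<t. h $$ (a, c) * A $$ (c, b))) =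
          (\<Sum>a<n. \<Sum>b<m. \<Sum>c<t. cnj (w (a, b)) * A $$ (c, b) * h $$ (a, c))"
        by (simp add: sum.cartesian_product[symmetric] sum_distrib_left ac_simps)
      also have "\<dots> = (\<Sum>a<n. \<Sum>c<t. \<Sum>b<m. cnj (w (a, b)) * A $$ (c, b) * h $$ (a, c))"
        by (intro sum.cong refl sum.swap)
      also have "\<dots> = (\<Sum>a<n. \<Sum>c<t. cnj (v (a, c)) * h $$ (a, c))"
        by (simp add: v_def sum_distrib_right)
      finally show ?thesis by (simp add: sum.cartesian_product case_prod_beta)
    qed
    then have "(CLINT x|M. iexp (Re (\<Sum>(a, b)\<in>?K. cnj (w (a, b)) * (\<Sum>c<t. H x $$ (a, c) * A $$ (c, b))))) =
        (CLINT x|M. iexp (Re (\<Sum>k\<in>?Kt. cnj (v k) * H x $$ k)))" by simp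
    also have "\<dots> = of_real (exp (- (\<Sum>k\<in>?Kt. (cmod (v k))\<^sup>2) / 4))"
      by (intro indep_std_circular_gaussian_char Hind Hstd) auto
    also have "(\<Sum>k\<in>?Kt. (cmod (v k))\<^sup>2) = (\<Sum>a<n. \<Sum>c<t. (cmod (\<Sum>b<m. w (a, b) * cnj (A $$ (c, b))))\<^sup>2)"
      by (simp add: sum.cartesian_product v_def case_prod_beta)
    also have "\<dots> = (\<Sum>k\<in>?K. (cmod (w k))\<^sup>2)"
      by (simp add: isometry_preserves_norm[OF A] sum.cartesian_product case_prod_beta)
    finally show ?thesis .
  qed
  define Z where "Z = (\<lambda>k \<omega>. (H \<omega> * T \<omega>) $$ k)"
  have prod_meas: "(\<lambda>\<omega>. H \<omega> * T \<omega>) \<in> M \<rightarrow>\<^sub>M borel_mat n m"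
  proof (rule measurable_borel_matI)
    show "H \<omega> * T \<omega> \<in> carrier_mat n m" if "\<omega> \<in> space M" for \<omega> using Hc[OF that] Tc[OF that] by simp
    show "(\<lambda>\<omega>. (H \<omega> * T \<omega>) $$ (i, j)) \<in> borel_measurable M" if "i < n" "j < m" for i j
    proof -
      have "(\<lambda>\<omega>. \<Sum>c<t. H \<omega> $$ (i, c) * T \<omega> $$ (c, j)) \<in> borel_measurable M"
        using that by (intro borel_measurable_sum borel_measurable_times measurable_mat_entry[OF Hm] measurable_mat_entry[OF T]) auto
      then show ?thesis
        by (rule measurable_cong[THEN iffD1, rotated]) (use index_mult_sum[OF Hc Tc that] in simp)
    qed
  qed
  have Zm[measurable]: "Z k \<in> borel_measurable M" if "k \<in> ?K" for k
    using that measurable_mat_entry[OF prod_meas] by (auto simp: Z_def)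
  have Vm[measurable]: "(\<lambda>\<omega>. H \<omega> $$ k) \<in> borel_measurable M" if "k \<in> ?Kt" for k
    using that measurable_mat_entry[OF Hm] by auto
  have char_prod: "(CLINT x|M. iexp (Re (\<Sum>k\<in>?K. cnj (w k) * Z k x))) =
      of_real (exp (- (\<Sum>k\<in>?K. (cmod (w k))\<^sup>2) / 4))" for w
  proof -
    \<comment> \<open>\<open>F\<close> separates the two random matrices and spells out the entries
      of \<open>h * A\<close> as sums, so that joint measurability can be read off
      entrywise.\<close>
    define F where "F = (\<lambda>h A. iexp (Re (\<Sum>(a, b)\<in>?K. cnj (w (a, b)) * (\<Sum>c<t. h $$ (a, c) * A $$ (c, b)))))"
    let ?H = "distr M (borel_mat n t) H" and ?T = "distr M (borel_mat t m) T"
    interpret PH: prob_space ?H by (rule prob_space_distr[OF Hm])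
    interpret PT: prob_space ?T by (rule prob_space_distr[OF T])
    interpret P: pair_prob_space ?H ?T ..
    have F: "case_prod F \<in> borel_measurable (borel_mat n t \<Otimes>\<^sub>M borel_mat t m)"
    proof -
      have "(\<lambda>p. \<Sum>k\<in>?K. cnj (w k) * (\<Sum>c<t. fst p $$ (fst k, c) * snd p $$ (c, snd k)))
          \<in> borel_measurable (borel_mat n t \<Otimes>\<^sub>M borel_mat t m)"
        by (intro borel_measurable_sum borel_measurable_times borel_measurable_const
            measurable_mat_entry[OF measurable_fst] measurable_mat_entry[OF measurable_snd]) auto
      from measurable_compose[OF this, of "\<lambda>z. iexp (Re z)" borel]
      show ?thesis by (simp add: F_def case_prod_beta del: Re_sum)
    qed
    have "(CLINT x|M. iexp (Re (\<Sum>k\<in>?K. cnj (w k) * Z k x))) = (CLINT x|M. F (H x) (T x))"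
      unfolding F_def Z_def
      by (intro Bochner_Integration.integral_cong refl arg_cong[of _ _ "\<lambda>z. iexp (Re z)"] sum.cong)
        (auto simp: index_mult_sum[OF Hc Tc])
    also have "\<dots> = (CLINT p|distr M (borel_mat n t \<Otimes>\<^sub>M borel_mat t m) (\<lambda>x. (H x, T x)). case_prod F p)"
      by (subst integral_distr[OF measurable_Pair[OF Hm T] F]) simp
    also have "\<dots> = (CLINT p|(?H \<Otimes>\<^sub>M ?T). case_prod F p)"
      using ind by (simp add: indep_var_distribution_eq)
    \<comment> \<open>Independence has turned the joint law into a product; Fubini now integrates
      over \<open>h\<close> first with \<open>A\<close> frozen, which is the conditioning on
      \<open>T\<close>.\<close>
    also have "\<dots> = (CLINT A|?T. CLINT h|?H. F h A)"
    proof (rule P.integral_snd[symmetric])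
      show "integrable (?H \<Otimes>\<^sub>M ?T) (case_prod F)"
        using F by (intro P.P.integrable_const_bound[of _ 1]) (auto simp: F_def case_prod_beta)
    qed
    also have "\<dots> = (CLINT y|M. CLINT h|?H. F h (T y))"
    proof (rule integral_distr[OF T])
      have "(\<lambda>(A, h). case_prod F (h, A)) \<in> borel_measurable (borel_mat t m \<Otimes>\<^sub>M ?H)"
        using measurable_pair_swap[OF F] by simp
      then show "(\<lambda>A. CLINT h|?H. F h A) \<in> borel_measurable (borel_mat t m)"
        by (intro PH.borel_measurable_lebesgue_integral) simp
    qed
    \<comment> \<open>The two sample points are now decoupled: \<open>y\<close> fixes the isometry,
      and \<open>char_given\<close> evaluates the inner integral over \<open>x\<close>.\<close>
    also have "\<dots> = (CLINT y|M. CLINT x|M. F (H x) (T y))"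
    proof (intro Bochner_Integration.integral_cong refl)
      fix y assume "y \<in> space M"
      then have "(\<lambda>h. F h (T y)) \<in> borel_measurable (borel_mat n t)"
        using measurable_compose[OF measurable_Pair2'[of "T y" "borel_mat t m" "borel_mat n t"] F] Tc by simp
      then show "(CLINT h|?H. F h (T y)) = (CLINT x|M. F (H x) (T y))"
        by (rule integral_distr[OF Hm])
    qed
    also have "\<dots> = (CLINT y|M. of_real (exp (- (\<Sum>k\<in>?K. (cmod (w k))\<^sup>2) / 4)))"
      unfolding F_def by (intro Bochner_Integration.integral_cong refl char_given Tc iso)
    also have "\<dots> = of_real (exp (- (\<Sum>k\<in>?K. (cmod (w k))\<^sup>2) / 4))" by (simp add: prob_space)
    finally show ?thesis .
  qed
  have joint: "distr M (\<Pi>\<^sub>M k\<in>?K. borel) (\<lambda>x. \<lambda>k\<in>?K. Z k x) = distr M (\<Pi>\<^sub>M k\<in>?K. borel) (\<lambda>x. \<lambda>k\<in>?K. H x $$ k)"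
  proof (rule distr_PiM_eq_of_joint_char_complex[OF prob_space_axioms prob_space_axioms])
    show "(CLINT x|M. iexp (Re (\<Sum>k\<in>?K. cnj (w k) * Z k x))) = (CLINT x|M. iexp (Re (\<Sum>k\<in>?K. cnj (w k) * H x $$ k)))" for w
      unfolding char_prod
      by (rule sym, rule indep_std_circular_gaussian_char[OF _ indep_vars_subset[OF Hind sub]]) (use sub Hstd in auto)
  qed (use sub Vm in auto)
  have marginal: "distr M borel (Z k) = distr M borel (\<lambda>x. H x $$ k)" if k: "k \<in> ?K" for k
  proof -
    have m: "distr M borel (U k) = distr (distr M (\<Pi>\<^sub>M k\<in>?K. borel) (\<lambda>x. \<lambda>k\<in>?K. U k x)) borel (\<lambda>f. f k)"
      if "\<And>k. k \<in> ?K \<Longrightarrow> U k \<in> borel_measurable M" for U :: "_ \<Rightarrow> 'a \<Rightarrow> complex"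
      by (subst distr_distr[OF measurable_component_singleton[OF k] measurable_restrict[OF that]])
        (use k in \<open>auto simp: comp_def\<close>)
    have "distr M borel (Z k) = distr (distr M (\<Pi>\<^sub>M k\<in>?K. borel) (\<lambda>x. \<lambda>k\<in>?K. H x $$ k)) borel (\<lambda>f. f k)"
      unfolding joint[symmetric] by (rule m) (rule Zm)
    also have "\<dots> = distr M borel (\<lambda>x. H x $$ k)"
      by (rule m[symmetric]) (use Vm sub in blast)
    finally show ?thesis .
  qed
  have indZ: "indep_vars (\<lambda>_. borel) Z ?K"
  \<comment> \<open>The characterisation of independence by product laws is applied to nonempty
    families. The empty family does occur, namely for \<open>m = 0\<close>, when the pre-coder has
    no columns.\<close>
  proof (cases "?K = {}")
    case True
    then show ?thesis unfolding True by (simp add: indep_vars_def indep_sets_def)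
  next
    case False
    \<comment> \<open>The comparison block has a product law; since joint law and marginals agree
      with those of \<open>Z\<close>, the law of \<open>Z\<close> is a product as well.\<close>
    have "distr M (\<Pi>\<^sub>M k\<in>?K. borel) (\<lambda>x. \<lambda>k\<in>?K. H x $$ k) = (\<Pi>\<^sub>M k\<in>?K. distr M borel (\<lambda>x. H x $$ k))"
      using indep_vars_subset[OF Hind sub] sub
      by (subst indep_vars_iff_distr_eq_PiM'[OF False, symmetric]) auto
    also have "\<dots> = (\<Pi>\<^sub>M k\<in>?K. distr M borel (Z k))"
      by (intro PiM_cong refl marginal[symmetric])
    finally show ?thesis
      by (subst indep_vars_iff_distr_eq_PiM'[OF False]) (auto simp: joint)
  qed
  show ?thesis
    unfolding ZMSW_def
  proof (intro conjI ballI)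
    show "indep_vars (\<lambda>_. borel) (\<lambda>k \<omega>. (H \<omega> * T \<omega>) $$ k) ?K" using indZ by (simp add: Z_def)
    fix k assume k: "k \<in> ?K"
    show "std_circular_gaussian M (\<lambda>\<omega>. (H \<omega> * T \<omega>) $$ k)"
      using std_circular_gaussian_distr[OF Zm[OF k]] std_circular_gaussian_distr[OF Vm] marginal[OF k] Hstd k sub
      by (auto simp: Z_def)
    show "distr M borel (\<lambda>\<omega>. (H \<omega> * T \<omega>) $$ k) = distr M borel (\<lambda>\<omega>. (H \<omega> * T \<omega>) $$ l)" if "l \<in> ?K" for l
      using marginal[OF k] marginal[OF that] Hid[of k l] k that sub by (auto simp: Z_def)
  qed (rule prod_meas)
qed

section \<open>Independence of the pre-coder and the direct channel\<close>

theorem proposition2: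
  fixes M :: "'w measure"
    and t r :: "nat \<Rightarrow> nat"
    and H :: "nat \<Rightarrow> nat \<Rightarrow> 'w \<Rightarrow> complex mat"
    and T :: "nat \<Rightarrow> 'w \<Rightarrow> complex mat"
  assumes "prob_space M"
    and "\<forall>i\<in>{1,2}. 0 < t i \<and> 0 < r i"
    and "\<forall>i\<in>{1,2}. \<forall>q\<in>{1,2}. ZMSW M (r i) (t q) (H i q)"
    and "prob_space.indep_vars M (\<lambda>(i, q). borel_mat (r i) (t q)) (\<lambda>(i, q). H i q) ({1,2} \<times> {1,2})"
    and "\<forall>i\<in>{1,2}. \<forall>j\<in>{1,2}. i \<noteq> j \<longrightarrow> r j \<le> t i"
    and "\<forall>i\<in>{1,2}. \<forall>j\<in>{1,2}. i \<noteq> j \<longrightarrow> precoding M (r j) (t i) (H j i) (T i)"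
  shows "\<forall>i\<in>{1,2}. \<forall>j\<in>{1,2}. i \<noteq> j \<longrightarrow>
           ZMSW M (r i) (t i - r j) (\<lambda>\<omega>. H i i \<omega> * T i \<omega>)"
proof (intro ballI impI)
  interpret prob_space M by fact
  fix i j :: nat assume ij: "i \<in> {1,2}" "j \<in> {1,2}" "i \<noteq> j"
  let ?m = "t i - r j"
  obtain W L q where
    g: "(\<lambda>G. select_cols (t i) ?m (W G) (q G)) \<in> borel_mat (t i) (t i) \<rightarrow>\<^sub>M borel_mat (t i) ?m"
    and W: "\<And>\<omega>. \<omega> \<in> space M \<Longrightarrow> let G = mat_adjoint (H j i \<omega>) * H j i \<omega> in
             eigendecomposition (t i) G (W G) (L G) \<and>
             null_selection (t i) ?m G (W G) (q G) \<and>
             T i \<omega> = select_cols (t i) ?m (W G) (q G)"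
    using assms(6) ij unfolding precoding_def by blast
  \<comment> \<open>The constant \<open>g\<close> expresses the pre-coder as a function of the cross
    channel \<open>H j i\<close>, by composing the Gram map with the selection.\<close>
  define g where "g = (\<lambda>A. let G = mat_adjoint A * A in select_cols (t i) ?m (W G) (q G))"
  have gm: "g \<in> borel_mat (r j) (t i) \<rightarrow>\<^sub>M borel_mat (t i) ?m"
    unfolding g_def Let_def by (rule measurable_compose[OF measurable_gram g])
  have Tg: "T i \<omega> = g (H j i \<omega>)" if "\<omega> \<in> space M" for \<omega>
    using W[OF that] by (simp add: g_def Let_def)
  have T_iso: "mat_adjoint (T i \<omega>) * T i \<omega> = 1\<^sub>m ?m" if "\<omega> \<in> space M" for \<omega>
    using W[OF that]
    by (auto simp: Let_def eigendecomposition_def null_selection_def intro!: gram_select_cols)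
  let ?S = "\<lambda>(i, q). borel_mat (r i) (t q)"
  \<comment> \<open>The index pairs \<open>(i, i)\<close> and \<open>(j, i)\<close> are distinct, so
    the corresponding singleton subfamilies are independent; composing with the projections, and
    with \<open>g\<close> on the second, brings this to \<open>H i i\<close> and the
    pre-coder.\<close>
  have "indep_var (PiM {(i, i)} ?S) (\<lambda>\<omega>. restrict (\<lambda>k. (case k of (i, q) \<Rightarrow> H i q) \<omega>) {(i, i)})
      (PiM {(j, i)} ?S) (\<lambda>\<omega>. restrict (\<lambda>k. (case k of (i, q) \<Rightarrow> H i q) \<omega>) {(j, i)})"
    using assms(4) by (rule indep_var_restrict) (use ij in auto)
  then have "indep_var (borel_mat (r i) (t i)) ((\<lambda>f. f (i, i)) \<circ> (\<lambda>\<omega>. restrict (\<lambda>k. (case k of (i, q) \<Rightarrow> H i q) \<omega>) {(i, i)}))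
      (borel_mat (t i) ?m) ((\<lambda>f. g (f (j, i))) \<circ> (\<lambda>\<omega>. restrict (\<lambda>k. (case k of (i, q) \<Rightarrow> H i q) \<omega>) {(j, i)}))"
  proof (rule indep_var_compose)
    show "(\<lambda>f. f (i, i)) \<in> PiM {(i, i)} ?S \<rightarrow>\<^sub>M borel_mat (r i) (t i)"
      using measurable_component_singleton[of "(i, i)" "{(i, i)}" ?S] by simp
    show "(\<lambda>f. g (f (j, i))) \<in> PiM {(j, i)} ?S \<rightarrow>\<^sub>M borel_mat (t i) ?m"
    proof -
      have "(\<lambda>f. f (j, i)) \<in> PiM {(j, i)} ?S \<rightarrow>\<^sub>M borel_mat (r j) (t i)"
        using measurable_component_singleton[of "(j, i)" "{(j, i)}" ?S] by simp
      then show ?thesis by (rule measurable_compose[OF _ gm])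
    qed
  qed
  then have g_ind: "indep_var (borel_mat (r i) (t i)) (H i i) (borel_mat (t i) ?m) (\<lambda>\<omega>. g (H j i \<omega>))"
    by (simp add: comp_def)
  have T_meas: "T i \<in> M \<rightarrow>\<^sub>M borel_mat (t i) ?m"
    using indep_var_rv2[OF g_ind] Tg by (simp cong: measurable_cong)
  \<comment> \<open>\<open>T i\<close> and \<open>g (H j i \<omega>)\<close> are known to agree only
    on \<open>space M\<close>. Independence is therefore transferred through laws, which depend only
    on the values there.\<close>
  have "distr M (borel_mat (t i) ?m) (T i) = distr M (borel_mat (t i) ?m) (\<lambda>\<omega>. g (H j i \<omega>))"
    by (intro distr_cong refl Tg)
  moreover have "distr M (borel_mat (r i) (t i) \<Otimes>\<^sub>M borel_mat (t i) ?m) (\<lambda>x. (H i i x, T i x)) =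
      distr M (borel_mat (r i) (t i) \<Otimes>\<^sub>M borel_mat (t i) ?m) (\<lambda>x. (H i i x, g (H j i x)))"
    by (intro distr_cong refl) (simp add: Tg)
  ultimately have "indep_var (borel_mat (r i) (t i)) (H i i) (borel_mat (t i) ?m) (T i)"
    using g_ind T_meas by (simp add: indep_var_distribution_eq)
  then show "ZMSW M (r i) ?m (\<lambda>\<omega>. H i i \<omega> * T i \<omega>)"
    using assms(3) ij by (intro ZMSW_mult_isometry[of "r i" "t i"] T_meas T_iso) auto
qed

end
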